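(* Suppose that $$\min\left(\frac{2\alpha\gamma}{\sigma^2\eta},\ \frac{2\alpha(\eta-\gamma)}{\sigma^2\eta}\right)>1$$ and that $\bar\Delta=\Delta_t/\Delta_x^2\le 1/2$. Let $u_m^n$ be the solution of the discrete random heat equation: for $n=0,\dots,N-1$, $$u_m^{n+1}=\bar\Delta\,u_{m+1}^n+(1-2\bar\Delta)u_m^n+\bar\Delta\,u_{m-1}^n,\quad m=1,\dots,M-1,$$ $$u_0^{n+1}=\widetilde\psi^{n+1},\qquad u_M^{n+1}=(1-2\bar\Delta)u_M^n+2\bar\Delta\,u_{M-1}^n,$$ with $u_0^0=\widetilde\psi^0$ and $u_m^0=0$ for $m=1,\dots,M$. Then the scheme is pathwise stable; precisely, there exists a constant $C_{T,\Delta_x}$, depending on $T$ and $\Delta_x$ but not on $n$ or $\omega$, such that for any $n\in\{1,\dots,N\}$ and any $\omega$ $$\|U^n(\omega)\|_{\Delta_x}\le C_{T,\Delta_x}\,\widetilde\eta .$$ Moreover, mean square stability holds: $\mathbb E\left[\|U^n\|_{\Delta_x}^2\right]\le C_{T,\Delta_x}^2\,\widetilde\eta^{\,2}$ for any $n\in\{1,\dots,N\}$. Furthermore, stability holds also in the maximum norm, both pathwise and in mean: there is a constant $C_T$ such that, for any $n\in\{1,\dots,N\}$ and any $\omega$, $$\|U^n(\omega)\|_{\max}\le C_T\,\widetilde\eta,\qquad \mathbb E\left[\|U^n\|_{\max}\right]\le C_T\,\widetilde\eta .$$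
   Context: Mesh: $T,\overline x>0$, $M,N\in\mathbb N$, $\Delta_x=\overline x/M$, $\Delta_t=T/N$, $\bar\Delta=\Delta_t/\Delta_x^2$, $t_n=n\Delta_t$, $x_m=m\Delta_x$. Parameters: $\alpha,\gamma,\sigma,\eta,\lambda,c_0>0$, $\gamma<\eta$; $\varphi(c)=\varphi_1+\varphi_2c$ with $\varphi_1>0$, $\varphi_2<0$, $\varphi(c_0)>0$; $\widetilde\eta=\eta/(\varphi_1+c_0\varphi_2)$. Boundary data: $W$ is a Wiener process and $\Psi$ is the $[0,\eta]$-valued solution of $d\Psi_t=\alpha(\gamma-\Psi_t)dt+\sigma\sqrt{\Psi_t(\eta-\Psi_t)}\,dW_t$, $\Psi_0=\psi^0\in[0,\eta]$. Its discretization $\psi^n$ is given by $y^0=2\arcsin\sqrt{\psi^0/\eta}$ and, for $n=1,\dots,N$, $$y^n=y^{n-1}+f_{\Delta}(y^{n-1})\Delta_t+\sigma(W_{t_n}-W_{t_{n-1}}),\qquad \psi^n=\eta\sin^2(y^n/2),$$ so that $\psi^n\in[0,\eta]$. The boundary values are $$\widetilde\psi^n=\frac{\psi^n}{\varphi\left(c_0\exp\left(-\lambda\int_0^{t_n}\Psi_u\,du\right)\right)} .$$ Here $f(y)=a_1\cot(y/2)-a_2\tan(y/2)$, $a_1=\frac{4\alpha\gamma-\sigma^2\eta}{4\eta}$, $a_2=\frac{4\alpha(\eta-\gamma)-\sigma^2\eta}{4\eta}$, $C_0=(2\alpha-\sigma^2)/4$, $y^*=2\arctan\sqrt{a_1/a_2}$,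 $k\in(0,1)$ is fixed, $\Delta=\Delta_t<\Delta^*:=\left(\min\{y^*,\pi-y^*,1\}\right)^{1/k}$, and, with $\epsilon=\Delta^k$, - $f_\Delta(y)=f(\epsilon)-\frac12\epsilon f'(\epsilon)-C_0(y-\frac12\epsilon)$ for $y<0$; - $f_\Delta(y)=f(\epsilon)+f'(\epsilon)(y-\epsilon)+\frac{1}{2\epsilon}(f'(\epsilon)+C_0)(y-\epsilon)^2$ for $0\le y<\epsilon$; - $f_\Delta(y)=f(y)$ for $\epsilon\le y\le\pi-\epsilon$; - $f_\Delta(y)=f(\pi-\epsilon)+f'(\pi-\epsilon)(y-\pi+\epsilon)-\frac{1}{2\epsilon}(f'(\pi-\epsilon)+C_0)(y-\pi+\epsilon)^2$ for $\pi-\epsilon<y\le\pi$; - $f_\Delta(y)=f(\pi-\epsilon)+\frac12\epsilon f'(\pi-\epsilon)-C_0(y-\pi+\frac12\epsilon)$ for $y>\pi$. Norms: $\|U^n\|_{\Delta_x}=\left(\Delta_x\sum_{m=0}^M|u_m^n|^2\right)^{1/2}$ and $\|U^n\|_{\max}=\max_{0\le m\le M}|u_m^n|$. *)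

theory Defs
  imports "HOL-Probability.Probability"
begin

section \<open>Wiener processes, Ito integrals and stochastic differential equations\<close>

text \<open>
  Processes are maps \<open>X :: real \<Rightarrow> 'a \<Rightarrow> real\<close> (time first), of which only times \<open>t \<ge> 0\<close> matter.
  \<open>F t\<close> is the \<open>\<sigma>\<close>-algebra of events known at time \<open>t\<close>, on the same sample space as \<open>P\<close>.
\<close>

definition wiener_process ::
  "'a measure \<Rightarrow> (real \<Rightarrow> 'a measure) \<Rightarrow> (real \<Rightarrow> 'a \<Rightarrow> real) \<Rightarrow> bool" where
  "wiener_process P F W \<longleftrightarrow>
     prob_space P \<and> filtration (space P) F \<and> (\<forall>t\<ge>0. subalgebra P (F t)) \<and>
     (\<forall>t\<ge>0. W t \<in> borel_measurable (F t)) \<and>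
     (AE \<omega> in P. W 0 \<omega> = 0) \<and>
     (AE \<omega> in P. continuous_on {0..} (\<lambda>t. W t \<omega>)) \<and>
     (\<forall>s t. 0 \<le> s \<and> s < t \<longrightarrow>
        distributed P lborel (\<lambda>\<omega>. W t \<omega> - W s \<omega>) (normal_density 0 (sqrt (t - s))) \<and>
        prob_space.indep_set P (sets (F s))
          {(\<lambda>\<omega>. W t \<omega> - W s \<omega>) -` A \<inter> space P | A. A \<in> sets borel})"

text \<open>
  An entry \<open>(a, b, \<xi>)\<close> of the list stands for the elementary integrand \<open>\<xi> \<cdot> 1\<^bsub>(a, b]\<^esub>\<close>; the
  list stands for the sum of its entries (the intervals need not be disjoint).
\<close>

type_synonym 'a simple_process = "(real \<times> real \<times> ('a \<Rightarrow> real)) list"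

definition simple_process :: "(real \<Rightarrow> 'a measure) \<Rightarrow> 'a simple_process \<Rightarrow> bool" where
  "simple_process F S \<longleftrightarrow>
     (\<forall>(a, b, \<xi>) \<in> set S. 0 \<le> a \<and> a \<le> b \<and> \<xi> \<in> borel_measurable (F a) \<and>
        (\<exists>K. \<forall>\<omega>\<in>space (F a). \<bar>\<xi> \<omega>\<bar> \<le> K))"

definition simple_value :: "'a simple_process \<Rightarrow> real \<Rightarrow> 'a \<Rightarrow> real" where
  "simple_value S u \<omega> = (\<Sum>(a, b, \<xi>)\<leftarrow>S. \<xi> \<omega> * indicator {a<..b} u)"

definition simple_ito :: "(real \<Rightarrow> 'a \<Rightarrow> real) \<Rightarrow> 'a simple_process \<Rightarrow> real \<Rightarrow> 'a \<Rightarrow> real" where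
  "simple_ito W S t \<omega> = (\<Sum>(a, b, \<xi>)\<leftarrow>S. \<xi> \<omega> * (W (min b t) \<omega> - W (min a t) \<omega>))"

definition progressive :: "(real \<Rightarrow> 'a measure) \<Rightarrow> real \<Rightarrow> (real \<Rightarrow> 'a \<Rightarrow> real) \<Rightarrow> bool" where
  "progressive F t H \<longleftrightarrow>
     (\<forall>s\<in>{0..t}. (\<lambda>(\<omega>, u). indicator {0..s} u * H u \<omega>) \<in> borel_measurable (F s \<Otimes>\<^sub>M lborel))"

text \<open>
  \<open>I\<close> is (a version of) \<open>\<integral>\<^sub>0\<^sup>t H dW\<close>: the mean square limit of the integrals of simple processes
  that approximate \<open>H\<close> in mean square on \<open>[0, t] \<times> \<Omega>\<close>.
\<close>

definition has_ito_integral ::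
  "'a measure \<Rightarrow> (real \<Rightarrow> 'a measure) \<Rightarrow> (real \<Rightarrow> 'a \<Rightarrow> real) \<Rightarrow> real \<Rightarrow>
   (real \<Rightarrow> 'a \<Rightarrow> real) \<Rightarrow> ('a \<Rightarrow> real) \<Rightarrow> bool" where
  "has_ito_integral P F W t H I \<longleftrightarrow>
     progressive F t H \<and> I \<in> borel_measurable P \<and>
     (\<exists>S :: nat \<Rightarrow> 'a simple_process.
        (\<forall>j. simple_process F (S j)) \<and>
        (\<lambda>j. \<integral>\<^sup>+\<omega>. (\<integral>\<^sup>+u\<in>{0..t}. ennreal ((H u \<omega> - simple_value (S j) u \<omega>)\<^sup>2) \<partial>lborel) \<partial>P)
          \<longlonglongrightarrow> 0 \<and>
        (\<lambda>j. \<integral>\<^sup>+\<omega>. ennreal ((I \<omega> - simple_ito W (S j) t \<omega>)\<^sup>2) \<partial>P) \<longlonglongrightarrow> 0)"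

text \<open>
  \<open>dX\<^sub>t = \<mu>(X\<^sub>t) dt + s(X\<^sub>t) dW\<^sub>t\<close> on \<open>[0, T]\<close> with \<open>X\<^sub>0 = x0\<close>, for an adapted process \<open>X\<close> all of whose
  paths are continuous.
\<close>

definition sde_solution ::
  "'a measure \<Rightarrow> (real \<Rightarrow> 'a measure) \<Rightarrow> (real \<Rightarrow> 'a \<Rightarrow> real) \<Rightarrow> real \<Rightarrow>
   (real \<Rightarrow> real) \<Rightarrow> (real \<Rightarrow> real) \<Rightarrow> real \<Rightarrow> (real \<Rightarrow> 'a \<Rightarrow> real) \<Rightarrow> bool" where
  "sde_solution P F W T \<mu> s x0 X \<longleftrightarrow>
     (\<forall>t\<in>{0..T}. X t \<in> borel_measurable (F t)) \<and>
     (\<forall>\<omega>\<in>space P. continuous_on {0..T} (\<lambda>t. X t \<omega>)) \<and>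
     (\<forall>t\<in>{0..T}. \<exists>I. has_ito_integral P F W t (\<lambda>u \<omega>. s (X u \<omega>)) I \<and>
        (AE \<omega> in P. X t \<omega> = x0 + (LINT u:{0..t}|lborel. \<mu> (X u \<omega>)) + I \<omega>))"


section \<open>Discretization of the boundary process\<close>

definition coef_a1 :: "real \<Rightarrow> real \<Rightarrow> real \<Rightarrow> real \<Rightarrow> real" where
  "coef_a1 \<alpha> \<gamma> \<sigma> \<eta> = (4 * \<alpha> * \<gamma> - \<sigma>\<^sup>2 * \<eta>) / (4 * \<eta>)"

definition coef_a2 :: "real \<Rightarrow> real \<Rightarrow> real \<Rightarrow> real \<Rightarrow> real" where
  "coef_a2 \<alpha> \<gamma> \<sigma> \<eta> = (4 * \<alpha> * (\<eta> - \<gamma>) - \<sigma>\<^sup>2 * \<eta>) / (4 * \<eta>)"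

definition coef_C0 :: "real \<Rightarrow> real \<Rightarrow> real" where
  "coef_C0 \<alpha> \<sigma> = (2 * \<alpha> - \<sigma>\<^sup>2) / 4"

definition y_star :: "real \<Rightarrow> real \<Rightarrow> real \<Rightarrow> real \<Rightarrow> real" where
  "y_star \<alpha> \<gamma> \<sigma> \<eta> = 2 * arctan (sqrt (coef_a1 \<alpha> \<gamma> \<sigma> \<eta> / coef_a2 \<alpha> \<gamma> \<sigma> \<eta>))"

definition Delta_star :: "real \<Rightarrow> real \<Rightarrow> real \<Rightarrow> real \<Rightarrow> real \<Rightarrow> real" where
  "Delta_star \<alpha> \<gamma> \<sigma> \<eta> k =
     Min {y_star \<alpha> \<gamma> \<sigma> \<eta>, pi - y_star \<alpha> \<gamma> \<sigma> \<eta>, 1} powr (1 / k)"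

definition drift :: "real \<Rightarrow> real \<Rightarrow> real \<Rightarrow> real \<Rightarrow> real \<Rightarrow> real" where
  "drift \<alpha> \<gamma> \<sigma> \<eta> y = coef_a1 \<alpha> \<gamma> \<sigma> \<eta> * cot (y / 2) - coef_a2 \<alpha> \<gamma> \<sigma> \<eta> * tan (y / 2)"

definition modified_drift ::
  "real \<Rightarrow> real \<Rightarrow> real \<Rightarrow> real \<Rightarrow> real \<Rightarrow> real \<Rightarrow> real \<Rightarrow> real" where
  "modified_drift \<alpha> \<gamma> \<sigma> \<eta> k \<Delta> y =
     (let \<epsilon> = \<Delta> powr k; f = drift \<alpha> \<gamma> \<sigma> \<eta>; f' = deriv f; C0 = coef_C0 \<alpha> \<sigma> in
      if y < 0 then
        f \<epsilon> - 1/2 * \<epsilon> * f' \<epsilon> - C0 * (y - 1/2 * \<epsilon>)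
      else if y < \<epsilon> then
        f \<epsilon> + f' \<epsilon> * (y - \<epsilon>) + 1 / (2 * \<epsilon>) * (f' \<epsilon> + C0) * (y - \<epsilon>)\<^sup>2
      else if y \<le> pi - \<epsilon> then
        f y
      else if y \<le> pi then
        f (pi - \<epsilon>) + f' (pi - \<epsilon>) * (y - pi + \<epsilon>)
          - 1 / (2 * \<epsilon>) * (f' (pi - \<epsilon>) + C0) * (y - pi + \<epsilon>)\<^sup>2
      else
        f (pi - \<epsilon>) + 1/2 * \<epsilon> * f' (pi - \<epsilon>) - C0 * (y - pi + 1/2 * \<epsilon>))"

primrec y_scheme ::
  "(real \<Rightarrow> real) \<Rightarrow> real \<Rightarrow> real \<Rightarrow> real \<Rightarrow> (real \<Rightarrow> 'a \<Rightarrow> real) \<Rightarrow> real \<Rightarrow> nat \<Rightarrow> 'a \<Rightarrow> real" where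
  "y_scheme f \<sigma> \<eta> \<psi>0 W dt 0 \<omega> = 2 * arcsin (sqrt (\<psi>0 / \<eta>))"
| "y_scheme f \<sigma> \<eta> \<psi>0 W dt (Suc n) \<omega> =
     y_scheme f \<sigma> \<eta> \<psi>0 W dt n \<omega> + f (y_scheme f \<sigma> \<eta> \<psi>0 W dt n \<omega>) * dt
       + \<sigma> * (W (real (Suc n) * dt) \<omega> - W (real n * dt) \<omega>)"

definition psi_scheme ::
  "(real \<Rightarrow> real) \<Rightarrow> real \<Rightarrow> real \<Rightarrow> real \<Rightarrow> (real \<Rightarrow> 'a \<Rightarrow> real) \<Rightarrow> real \<Rightarrow> nat \<Rightarrow> 'a \<Rightarrow> real" where
  "psi_scheme f \<sigma> \<eta> \<psi>0 W dt n \<omega> =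
     (if n = 0 then \<psi>0 else \<eta> * (sin (y_scheme f \<sigma> \<eta> \<psi>0 W dt n \<omega> / 2))\<^sup>2)"

definition phi :: "real \<Rightarrow> real \<Rightarrow> real \<Rightarrow> real" where
  "phi \<phi>1 \<phi>2 c = \<phi>1 + \<phi>2 * c"

text \<open>The first argument is the discretization \<open>\<psi>\<close>, the second the process \<open>\<Psi>\<close> itself.\<close>

definition boundary_value ::
  "(nat \<Rightarrow> 'a \<Rightarrow> real) \<Rightarrow> (real \<Rightarrow> 'a \<Rightarrow> real) \<Rightarrow> real \<Rightarrow> real \<Rightarrow> real \<Rightarrow> real \<Rightarrow> real \<Rightarrow>
   nat \<Rightarrow> 'a \<Rightarrow> real" where
  "boundary_value \<psi> \<Psi> \<phi>1 \<phi>2 c0 lam dt n \<omega> =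
     \<psi> n \<omega> / phi \<phi>1 \<phi>2 (c0 * exp (- lam * (LINT s:{0..real n * dt}|lborel. \<Psi> s \<omega>)))"


section \<open>The discrete random heat equation\<close>

text \<open>\<open>u n m \<omega>\<close> is the value at time level \<open>n \<le> N\<close> and space index \<open>m \<le> M\<close>.\<close>

definition heat_scheme_solution ::
  "'a measure \<Rightarrow> nat \<Rightarrow> nat \<Rightarrow> real \<Rightarrow> (nat \<Rightarrow> 'a \<Rightarrow> real) \<Rightarrow> (nat \<Rightarrow> nat \<Rightarrow> 'a \<Rightarrow> real) \<Rightarrow> bool" where
  "heat_scheme_solution P M N D b u \<longleftrightarrow>
     (\<forall>\<omega>\<in>space P.
        u 0 0 \<omega> = b 0 \<omega> \<and>
        (\<forall>m\<in>{1..M}. u 0 m \<omega> = 0) \<and>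
        (\<forall>n<N.
           (\<forall>m\<in>{1..<M}. u (n + 1) m \<omega> =
              D * u n (m + 1) \<omega> + (1 - 2 * D) * u n m \<omega> + D * u n (m - 1) \<omega>) \<and>
           u (n + 1) 0 \<omega> = b (n + 1) \<omega> \<and>
           u (n + 1) M \<omega> = (1 - 2 * D) * u n M \<omega> + 2 * D * u n (M - 1) \<omega>))"

definition norm_dx :: "real \<Rightarrow> nat \<Rightarrow> (nat \<Rightarrow> real) \<Rightarrow> real" where
  "norm_dx dx M v = sqrt (dx * (\<Sum>m=0..M. \<bar>v m\<bar>\<^sup>2))"

definition norm_max :: "nat \<Rightarrow> (nat \<Rightarrow> real) \<Rightarrow> real" where
  "norm_max M v = Max ((\<lambda>m. \<bar>v m\<bar>) ` {0..M})"

end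

theory Submission
  imports Defs
begin

text \<open>
  The boundary values lie in \<open>[0, \<eta>t]\<close>, because \<open>\<phi>\<close> is decreasing and the concentration never
  exceeds \<open>c0\<close>. Since \<open>D \<le> 1/2\<close>, every step of the scheme takes convex combinations, so the whole
  solution stays in \<open>[0, \<eta>t]\<close>; this is the maximum norm bound, with constant \<open>1\<close>. For the
  \<open>L\<^sup>2\<close> norm, the mass \<open>u\<^sub>1 + \<dots> + u\<^bsub>M-1\<^esub> + u\<^sub>M / 2\<close> changes in each step only by the boundary flux
  \<open>D (u\<^sub>0 - u\<^sub>1) \<le> D \<eta>t\<close>, and \<open>n D \<le> T / dx\<^sup>2\<close>. As \<open>u\<^sup>2 \<le> \<eta>t u\<close>, this bounds the norm by
  a constant in which the length \<open>xbar\<close> of the space interval does not occur.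
\<close>

section \<open>Deterministic bounds for the recursion\<close>

lemma telescope_second_difference:
  fixes w :: "nat \<Rightarrow> real"
  assumes "1 \<le> K"
  shows "(\<Sum>m\<in>{1..<K}. w (m + 1) - 2 * w m + w (m - 1)) = (w K - w (K - 1)) - (w 1 - w 0)"
  using assms by (induction K rule: nat_induct_at_least) auto

text \<open>The scheme along a single path: \<open>b\<close> is the boundary data at one fixed
  sample point and \<open>B\<close> its upper bound, so all estimates below are free of probability.
  Nothing is assumed about \<open>v\<close> beyond time level \<open>N\<close> or space index
  \<open>M\<close>.\<close>

locale heat_recursion =
  fixes M N :: nat and D B :: real and b :: "nat \<Rightarrow> real" and v :: "nat \<Rightarrow> nat \<Rightarrow> real"
  assumes M_pos: "1 \<le> M"
    and D_nonneg: "0 \<le> D" and D_le: "D \<le> 1 / 2"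
    and b_nonneg: "n \<le> N \<Longrightarrow> 0 \<le> b n" and b_le: "n \<le> N \<Longrightarrow> b n \<le> B"
    and init_left: "v 0 0 = b 0"
    and init: "m \<in> {1..M} \<Longrightarrow> v 0 m = 0"
    and step: "n < N \<Longrightarrow> m \<in> {1..<M} \<Longrightarrow>
      v (Suc n) m = D * v n (m + 1) + (1 - 2 * D) * v n m + D * v n (m - 1)"
    and step_left: "n < N \<Longrightarrow> v (Suc n) 0 = b (Suc n)"
    and step_right: "n < N \<Longrightarrow> v (Suc n) M = (1 - 2 * D) * v n M + 2 * D * v n (M - 1)"
begin

lemma B_nonneg: "0 \<le> B"
  using b_nonneg[of 0] b_le[of 0] by simp

text \<open>Away from the left end, each new value is an average of old ones: the weights are
  nonnegative because \<open>D \<le> 1 / 2\<close>, and they sum to 1. The left end is controlled by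
  the boundary data itself.\<close>

lemma maximum_principle: "n \<le> N \<Longrightarrow> m \<le> M \<Longrightarrow> v n m \<in> {0..B}"
proof (induction n arbitrary: m)
  case 0
  then show ?case
    using b_nonneg[of 0] b_le[of 0] init[of m] B_nonneg by (cases "m = 0") (auto simp: init_left)
next
  case (Suc n)
  have convex: "p * x + q * y + r * z \<in> {0..B}"
    if "x \<in> {0..B}" "y \<in> {0..B}" "z \<in> {0..B}" "0 \<le> p" "0 \<le> q" "0 \<le> r" "p + q + r = 1"
    for p q r x y z :: real
  proof -
    have "p * x \<le> p * B" "q * y \<le> q * B" "r * z \<le> r * B"
      using that by (auto intro: mult_left_mono)
    moreover have "p * B + q * B + r * B = B"
      using that(7) by (metis distrib_right mult_1)
    ultimately show ?thesis
      using that by (auto intro!: add_nonneg_nonneg)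
  qed
  consider "m = 0" | "m \<in> {1..<M}" | "m = M"
    using Suc.prems by force
  then show ?case
  proof cases
    case 1
    then show ?thesis
      using Suc.prems b_nonneg b_le by (auto simp: step_left)
  next
    case 2
    then have "v n (m + 1) \<in> {0..B}" "v n m \<in> {0..B}" "v n (m - 1) \<in> {0..B}"
      using Suc by (auto simp del: atLeastAtMost_iff)
    from convex[OF this, of D "1 - 2 * D" D] show ?thesis
      using 2 Suc.prems D_nonneg D_le by (simp only: step)
  next
    \<comment> \<open>Only two old values enter at the right end, with weights
      \<open>1 - 2 * D\<close> and \<open>2 * D\<close>. The third slot of \<open>convex\<close> is
      filled by the value 0 with weight 0.\<close>
    case 3
    then show ?thesis
      using Suc convex[of "v n M" "v n (M - 1)" 0 "1 - 2 * D" "2 * D" 0] D_nonneg D_le B_nonneg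
      by (simp add: step_right)
  qed
qed

text \<open>Trapezoidal weighting at the right end: the factor 1/2 matches the doubled coefficient
  \<open>2 * D\<close> of the reflecting condition there. Node 0 is left out because its value is
  prescribed.\<close>

definition mass :: "nat \<Rightarrow> real" where
  "mass n = (\<Sum>m\<in>{1..<M}. v n m) + v n M / 2"

text \<open>The second differences telescope to one flux at each end. Half of the update at
  \<open>M\<close> contributes \<open>D * (v n (M - 1) - v n M)\<close>, which cancels the right
  flux, so only the left one survives.\<close>

lemma mass_step: "n < N \<Longrightarrow> mass (Suc n) = mass n + D * (v n 0 - v n 1)"
proof -
  assume n: "n < N"
  have "(\<Sum>m\<in>{1..<M}. v (Suc n) m)
      = (\<Sum>m\<in>{1..<M}. v n m + D * (v n (m + 1) - 2 * v n m + v n (m - 1)))"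
    by (rule sum.cong) (use n in \<open>auto simp: step algebra_simps\<close>)
  also have "\<dots> = (\<Sum>m\<in>{1..<M}. v n m) + D * ((v n M - v n (M - 1)) - (v n 1 - v n 0))"
    by (subst sum.distrib, subst sum_distrib_left[symmetric])
      (simp only: telescope_second_difference[OF M_pos])
  finally show ?thesis
    using n by (simp add: mass_def step_right field_simps)
qed

text \<open>The initial mass is 0, and by the maximum principle one step adds at most
  \<open>D * B\<close>.\<close>

lemma mass_le: "n \<le> N \<Longrightarrow> mass n \<le> real n * D * B"
proof (induction n)
  case 0
  then show ?case
    using M_pos by (simp add: mass_def init)
next
  case (Suc n)
  have "v n 0 - v n 1 \<le> B"
    using maximum_principle[of n 0] maximum_principle[of n 1] M_pos Suc.prems by simp
  then have "D * (v n 0 - v n 1) \<le> D * B"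
    using D_nonneg by (rule mult_left_mono)
  then show ?case
    using Suc mass_step[of n] by (simp add: algebra_simps)
qed

lemma sum_squares_le:
  assumes n: "n \<le> N"
  shows "(\<Sum>m=0..M. \<bar>v n m\<bar>\<^sup>2) \<le> (1 + 2 * (real n * D)) * B\<^sup>2"
proof -
  have "(\<Sum>m=0..M. \<bar>v n m\<bar>\<^sup>2) \<le> (\<Sum>m=0..M. B * v n m)"
  proof (rule sum_mono)
    fix m assume "m \<in> {0..M}"
    then have "v n m \<in> {0..B}"
      using maximum_principle n by simp
    then show "\<bar>v n m\<bar>\<^sup>2 \<le> B * v n m"
      by (simp add: power2_eq_square mult_right_mono)
  qed
  also have "\<dots> = B * (\<Sum>m=0..M. v n m)"
    by (simp add: sum_distrib_left)
  also have "\<dots> \<le> B * (B + 2 * (real n * D * B))"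
  proof (rule mult_left_mono[OF _ B_nonneg])
    have "{0..M} = insert 0 (insert M {1..<M})"
      using M_pos by auto
    then have "(\<Sum>m=0..M. v n m) = v n 0 + 2 * mass n - (\<Sum>m\<in>{1..<M}. v n m)"
      using M_pos by (simp add: mass_def)
    moreover have "0 \<le> (\<Sum>m\<in>{1..<M}. v n m)"
      using maximum_principle n by (intro sum_nonneg) auto
    ultimately show "(\<Sum>m=0..M. v n m) \<le> B + 2 * (real n * D * B)"
      using mass_le[OF n] maximum_principle[OF n, of 0] by simp
  qed
  finally show ?thesis
    by (simp add: power2_eq_square algebra_simps)
qed

lemma norm_dx_le:
  assumes "n \<le> N" "0 \<le> dx"
  shows "norm_dx dx M (v n) \<le> sqrt (dx * (1 + 2 * (real n * D))) * B"
proof -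
  have "norm_dx dx M (v n) \<le> sqrt (dx * ((1 + 2 * (real n * D)) * B\<^sup>2))"
    unfolding norm_dx_def using sum_squares_le[OF assms(1)] assms(2)
    by (intro real_sqrt_le_mono mult_left_mono)
  also have "\<dots> = sqrt (dx * (1 + 2 * (real n * D))) * B"
    using B_nonneg by (simp add: real_sqrt_mult mult.assoc)
  finally show ?thesis .
qed

lemma norm_max_le: "n \<le> N \<Longrightarrow> norm_max M (v n) \<le> B"
  using maximum_principle unfolding norm_max_def by (intro Max.boundedI) auto

end

section \<open>Signs of the norms and range of the boundary values\<close>

lemma norm_dx_nonneg: "0 \<le> dx \<Longrightarrow> 0 \<le> norm_dx dx M w"
  unfolding norm_dx_def by (intro real_sqrt_ge_zero mult_nonneg_nonneg sum_nonneg) auto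

lemma norm_max_nonneg: "0 \<le> norm_max M w"
  unfolding norm_max_def by (subst Max_ge_iff) auto

lemma boundary_value_bounds:
  assumes \<psi>: "0 \<le> \<psi> n \<omega>" "\<psi> n \<omega> \<le> \<eta>"
    and \<Psi>: "\<And>s. s \<in> {0..real n * dt} \<Longrightarrow> 0 \<le> \<Psi> s \<omega>"
    and "0 \<le> lam" "0 \<le> c0" "\<phi>2 \<le> 0" "0 < phi \<phi>1 \<phi>2 c0"
  shows "0 \<le> boundary_value \<psi> \<Psi> \<phi>1 \<phi>2 c0 lam dt n \<omega>"
    and "boundary_value \<psi> \<Psi> \<phi>1 \<phi>2 c0 lam dt n \<omega> \<le> \<eta> / phi \<phi>1 \<phi>2 c0"
proof -
  define c where "c = c0 * exp (- lam * (LINT s:{0..real n * dt}|lborel. \<Psi> s \<omega>))"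
  \<comment> \<open>Integrability is no issue for the sign: a Bochner integral that does not exist
    has the default value 0.\<close>
  have "0 \<le> (LINT s:{0..real n * dt}|lborel. \<Psi> s \<omega>)"
    unfolding set_lebesgue_integral_def using \<Psi>
    by (intro Bochner_Integration.integral_nonneg) (auto simp: indicator_def)
  then have "exp (- lam * (LINT s:{0..real n * dt}|lborel. \<Psi> s \<omega>)) \<le> 1"
    using \<open>0 \<le> lam\<close> by simp
  then have "c \<le> c0"
    unfolding c_def using \<open>0 \<le> c0\<close> mult_left_le by blast
  then have le: "phi \<phi>1 \<phi>2 c0 \<le> phi \<phi>1 \<phi>2 c"
    using \<open>\<phi>2 \<le> 0\<close> by (simp add: phi_def mult_left_mono_neg)
  have eq: "boundary_value \<psi> \<Psi> \<phi>1 \<phi>2 c0 lam dt n \<omega> = \<psi> n \<omega> / phi \<phi>1 \<phi>2 c"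
    by (simp add: boundary_value_def c_def)
  show "0 \<le> boundary_value \<psi> \<Psi> \<phi>1 \<phi>2 c0 lam dt n \<omega>"
    unfolding eq using \<psi> le assms(7) by simp
  show "boundary_value \<psi> \<Psi> \<phi>1 \<phi>2 c0 lam dt n \<omega> \<le> \<eta> / phi \<phi>1 \<phi>2 c0"
    unfolding eq using \<psi> le assms(7) by (intro frac_le) auto
qed

lemma psi_scheme_bounds:
  assumes "\<psi>0 \<in> {0..\<eta>}"
  shows "psi_scheme f \<sigma> \<eta> \<psi>0 W dt n \<omega> \<in> {0..\<eta>}"
proof -
  \<comment> \<open>That \<eta> is nonnegative follows from the interval \<open>{0..\<eta>}\<close>
    containing \<open>\<psi>0\<close>.\<close>
  have "\<eta> * (sin x)\<^sup>2 \<in> {0..\<eta>}" for x :: real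
    using assms mult_left_mono[of "(sin x)\<^sup>2" 1 \<eta>] by (simp add: abs_square_le_1)
  then show ?thesis
    using assms by (simp add: psi_scheme_def)
qed

section \<open>Measurability of the boundary data and of the solution\<close>

lemma modified_drift_measurable [measurable]:
  "modified_drift \<alpha> \<gamma> \<sigma> \<eta> k \<Delta> \<in> borel_measurable borel"
proof -
  have [measurable]: "drift \<alpha> \<gamma> \<sigma> \<eta> \<in> borel_measurable borel"
    unfolding drift_def[abs_def] cot_def tan_def by measurable
  \<comment> \<open>The derivative of the drift occurs only at the two fixed points \<epsilon> and
    \<open>pi - \<epsilon>\<close>, hence as a constant; its measurability as a function never
    arises.\<close>
  show ?thesis
    unfolding modified_drift_def[abs_def] Let_def by measurable
qed

lemma y_scheme_measurable:
  assumes [measurable]: "f \<in> borel_measurable borel"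
    and W: "\<And>t. 0 \<le> t \<Longrightarrow> W t \<in> borel_measurable P" and "0 \<le> dt"
  shows "y_scheme f \<sigma> \<eta> \<psi>0 W dt n \<in> borel_measurable P"
proof (induction n)
  case 0
  then show ?case by simp
next
  case (Suc n)
  have [measurable]: "W (real (Suc n) * dt) \<in> borel_measurable P"
    "W (real n * dt) \<in> borel_measurable P"
    using \<open>0 \<le> dt\<close> by (auto intro!: W mult_nonneg_nonneg)
  note Suc [measurable]
  show ?case
    unfolding y_scheme.simps[abs_def] by measurable
qed

lemma psi_scheme_measurable:
  assumes "f \<in> borel_measurable borel"
    and "\<And>t. 0 \<le> t \<Longrightarrow> W t \<in> borel_measurable P" and "0 \<le> dt"
  shows "psi_scheme f \<sigma> \<eta> \<psi>0 W dt n \<in> borel_measurable P"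
proof -
  have [measurable]: "y_scheme f \<sigma> \<eta> \<psi>0 W dt n \<in> borel_measurable P"
    using assms by (rule y_scheme_measurable)
  show ?thesis
    unfolding psi_scheme_def[abs_def] by measurable
qed

text \<open>
  A process with continuous paths is the pointwise limit of the step processes
  \<open>(u, \<omega>) \<mapsto> X (\<lfloor>j u\<rfloor> / j) \<omega>\<close>, which are jointly measurable.
\<close>
lemma time_integral_measurable:
  fixes X :: "real \<Rightarrow> 'a \<Rightarrow> real"
  assumes X: "\<And>s. s \<in> {0..t} \<Longrightarrow> X s \<in> borel_measurable P"
    and cont: "\<And>\<omega>. \<omega> \<in> space P \<Longrightarrow> continuous_on {0..t} (\<lambda>s. X s \<omega>)"
  shows "(\<lambda>\<omega>. LINT s:{0..t}|lborel. X s \<omega>) \<in> borel_measurable P"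
proof -
  \<comment> \<open>Rounding down keeps the grid time inside \<open>{0..t}\<close> whenever
    \<open>s\<close> lies there, and \<open>Suc j\<close> avoids division by 0.\<close>
  define g where "g j s = real_of_int \<lfloor>real (Suc j) * s\<rfloor> / real (Suc j)" for j s
  have g_le: "g j s \<le> s" for j s
    using of_int_floor_le[of "real (Suc j) * s"] by (simp add: g_def field_simps)
  have g_ge: "s - 1 / real (Suc j) \<le> g j s" for j s
  proof -
    have "s - 1 / real (Suc j) = (real (Suc j) * s - 1) / real (Suc j)"
      by (simp add: field_simps)
    also have "\<dots> \<le> g j s"
      unfolding g_def using real_of_int_floor_add_one_ge[of "real (Suc j) * s"]
      by (intro divide_right_mono; linarith)
    finally show ?thesis .
  qed
  have g_nonneg: "0 \<le> g j s" if "0 \<le> s" for j s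
    using that by (simp add: g_def)
  \<comment> \<open>\<open>X\<close> is known to be measurable only at times in
    \<open>{0..t}\<close>, so the value 0 replaces it at grid times outside.\<close>
  define step where
    "step j p = indicator {0..t} (snd p) * (if g j (snd p) \<in> {0..t} then X (g j (snd p)) (fst p) else 0)"
    for j and p :: "'a \<times> real"
  have [measurable]: "step j \<in> borel_measurable (P \<Otimes>\<^sub>M lborel)" for j
  proof -
    \<comment> \<open>With the integer \<open>i\<close> frozen, the time is a constant and only the
      sample point varies. Since the floor takes countably many values, substituting it for
      \<open>i\<close> preserves measurability.\<close>
    have 1: "(\<lambda>p. if real_of_int i / real (Suc j) \<in> {0..t}
        then X (real_of_int i / real (Suc j)) (fst p) else 0) \<in> borel_measurable (P \<Otimes>\<^sub>M lborel)"
      for i :: int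
      using X[of "real_of_int i / real (Suc j)"]
      by (cases "real_of_int i / real (Suc j) \<in> {0..t}")
        (auto intro: measurable_compose[OF measurable_fst])
    have 2: "(\<lambda>p. \<lfloor>real (Suc j) * snd p\<rfloor>) \<in> measurable (P \<Otimes>\<^sub>M lborel) (count_space UNIV)"
      by measurable
    have "(\<lambda>p. if g j (snd p) \<in> {0..t} then X (g j (snd p)) (fst p) else 0)
        \<in> borel_measurable (P \<Otimes>\<^sub>M lborel)"
      unfolding g_def by (rule measurable_compose_countable[OF 1 2])
    then show ?thesis
      unfolding step_def[abs_def] by (rule borel_measurable_times[rotated]) measurable
  qed
  have "(\<lambda>p. indicator {0..t} (snd p) * X (snd p) (fst p)) \<in> borel_measurable (P \<Otimes>\<^sub>M lborel)"
  proof (rule borel_measurable_LIMSEQ_real)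
    fix p :: "'a \<times> real" assume p: "p \<in> space (P \<Otimes>\<^sub>M lborel)"
    show "(\<lambda>j. step j p) \<longlonglongrightarrow> indicator {0..t} (snd p) * X (snd p) (fst p)"
    proof (cases "snd p \<in> {0..t}")
      case True
      define s where "s = snd p"
      have \<omega>: "fst p \<in> space P"
        using p by (auto simp: space_pair_measure)
      have g_in: "g j s \<in> {0..t}" for j
        using True g_le[of j s] g_nonneg[of s j] by (auto simp: s_def)
      have "(\<lambda>j. s - 1 / real (Suc j)) \<longlonglongrightarrow> s - 0"
        by (intro tendsto_diff tendsto_const LIMSEQ_Suc[OF lim_1_over_n])
      then have "(\<lambda>j. g j s) \<longlonglongrightarrow> s"
        using tendsto_sandwich[of "\<lambda>j. s - 1 / real (Suc j)" "\<lambda>j. g j s" sequentially "\<lambda>_. s" s]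
          g_le g_ge by (simp del: of_nat_Suc)
      then have "(\<lambda>j. X (g j s) (fst p)) \<longlonglongrightarrow> X s (fst p)"
        by (rule continuous_on_tendsto_compose[OF cont[OF \<omega>]]) (use True g_in in \<open>auto simp: s_def\<close>)
      then show ?thesis
        using True g_in by (simp add: step_def s_def)
    qed (simp add: step_def)
  qed measurable
  then have "(\<lambda>\<omega>. LINT s|lborel. indicator {0..t} s * X s \<omega>) \<in> borel_measurable P"
    by (intro lborel.borel_measurable_lebesgue_integral) (simp add: case_prod_beta)
  then show ?thesis
    by (simp add: set_lebesgue_integral_def)
qed

text \<open>Each value is a linear combination of boundary data and earlier values. The scheme
  determines \<open>u\<close> on \<open>space P\<close> only, so every case passes through
  \<open>measurable_cong\<close>.\<close>

lemma heat_scheme_solution_measurable: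
  assumes sol: "heat_scheme_solution P M N D b u" and "1 \<le> M"
    and b: "\<And>n. n \<le> N \<Longrightarrow> b n \<in> borel_measurable P"
  shows "n \<le> N \<Longrightarrow> m \<le> M \<Longrightarrow> u n m \<in> borel_measurable P"
proof (induction n arbitrary: m)
  case 0
  have "u 0 m \<in> borel_measurable P \<longleftrightarrow> (if m = 0 then b 0 else (\<lambda>_. 0)) \<in> borel_measurable P"
    by (rule measurable_cong) (use sol 0 in \<open>auto simp: heat_scheme_solution_def\<close>)
  then show ?case
    using b by simp
next
  case (Suc n)
  have u_n: "u n j \<in> borel_measurable P" if "j \<le> M" for j
    using Suc that by simp
  consider "m = 0" | "m \<in> {1..<M}" | "m = M"
    using Suc.prems by force
  then show ?case
  proof cases
    case 1
    have "u (Suc n) m \<in> borel_measurable P \<longleftrightarrow> b (Suc n) \<in> borel_measurable P"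
      by (rule measurable_cong) (use sol 1 Suc.prems in \<open>auto simp: heat_scheme_solution_def\<close>)
    then show ?thesis
      using b Suc.prems by simp
  next
    case 2
    have [measurable]: "u n (m + 1) \<in> borel_measurable P" "u n m \<in> borel_measurable P"
      "u n (m - 1) \<in> borel_measurable P"
      using 2 by (auto intro!: u_n)
    have "u (Suc n) m \<in> borel_measurable P \<longleftrightarrow>
        (\<lambda>\<omega>. D * u n (m + 1) \<omega> + (1 - 2 * D) * u n m \<omega> + D * u n (m - 1) \<omega>) \<in> borel_measurable P"
      by (rule measurable_cong) (use sol 2 Suc.prems in \<open>auto simp: heat_scheme_solution_def\<close>)
    then show ?thesis
      by (rule iffD2) measurable
  next
    case 3
    have [measurable]: "u n M \<in> borel_measurable P" "u n (M - 1) \<in> borel_measurable P"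
      by (auto intro!: u_n)
    have "u (Suc n) m \<in> borel_measurable P \<longleftrightarrow>
        (\<lambda>\<omega>. (1 - 2 * D) * u n M \<omega> + 2 * D * u n (M - 1) \<omega>) \<in> borel_measurable P"
      by (rule measurable_cong) (use sol 3 Suc.prems in \<open>auto simp: heat_scheme_solution_def\<close>)
    then show ?thesis
      by (rule iffD2) measurable
  qed
qed

section \<open>Expectations and the stability theorem\<close>

lemma (in prob_space) expectation_bounded:
  fixes X :: "'a \<Rightarrow> real"
  assumes "X \<in> borel_measurable M" and "\<And>\<omega>. \<omega> \<in> space M \<Longrightarrow> 0 \<le> X \<omega>"
    and "\<And>\<omega>. \<omega> \<in> space M \<Longrightarrow> X \<omega> \<le> K"
  shows "integrable M X" "expectation X \<le> K"
proof -
  show int: "integrable M X"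
    using assms by (intro integrable_const_bound[of _ K]) auto
  show "expectation X \<le> K"
    using assms by (intro integral_le_const[OF int]) auto
qed

text \<open>The constants are functions chosen before all other data and applied only to
  \<open>T\<close> and \<open>dx\<close>, or to \<open>T\<close> alone, which makes them independent
  of \<open>n\<close> and of the sample point. Integrability is part of the conclusion because the
  expectation of a nonintegrable function would be 0 by convention.\<close>

theorem proposition4p2:
  "\<exists>(C_Tdx :: real \<Rightarrow> real \<Rightarrow> real) (C_T :: real \<Rightarrow> real).
     \<forall>(P :: 'a measure) (F :: real \<Rightarrow> 'a measure) (W :: real \<Rightarrow> 'a \<Rightarrow> real)
       (\<Psi> :: real \<Rightarrow> 'a \<Rightarrow> real) (u :: nat \<Rightarrow> nat \<Rightarrow> 'a \<Rightarrow> real)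
       (T :: real) (xbar :: real) (M :: nat) (N :: nat) (dx :: real) (dt :: real) (D :: real)
       (\<alpha> :: real) (\<gamma> :: real) (\<sigma> :: real) (\<eta> :: real) (lam :: real) (c0 :: real)
       (\<phi>1 :: real) (\<phi>2 :: real) (\<eta>t :: real) (\<psi>0 :: real) (k :: real)
       (\<psi> :: nat \<Rightarrow> 'a \<Rightarrow> real) (\<psi>t :: nat \<Rightarrow> 'a \<Rightarrow> real).
       T > 0 \<and> xbar > 0 \<and> M \<ge> 1 \<and> N \<ge> 1 \<and>
       dx = xbar / real M \<and> dt = T / real N \<and> D = dt / dx\<^sup>2 \<and>
       \<alpha> > 0 \<and> \<gamma> > 0 \<and> \<sigma> > 0 \<and> \<eta> > 0 \<and> lam > 0 \<and> c0 > 0 \<and> \<gamma> < \<eta> \<and>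
       \<phi>1 > 0 \<and> \<phi>2 < 0 \<and> phi \<phi>1 \<phi>2 c0 > 0 \<and> \<eta>t = \<eta> / (\<phi>1 + c0 * \<phi>2) \<and>
       \<psi>0 \<in> {0..\<eta>} \<and>
       wiener_process P F W \<and>
       sde_solution P F W T (\<lambda>x. \<alpha> * (\<gamma> - x)) (\<lambda>x. \<sigma> * sqrt (x * (\<eta> - x))) \<psi>0 \<Psi> \<and>
       (\<forall>t\<in>{0..T}. \<forall>\<omega>\<in>space P. \<Psi> t \<omega> \<in> {0..\<eta>}) \<and>
       0 < k \<and> k < 1 \<and> dt < Delta_star \<alpha> \<gamma> \<sigma> \<eta> k \<and>
       \<psi> = psi_scheme (modified_drift \<alpha> \<gamma> \<sigma> \<eta> k dt) \<sigma> \<eta> \<psi>0 W dt \<and>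
       \<psi>t = boundary_value \<psi> \<Psi> \<phi>1 \<phi>2 c0 lam dt \<and>
       min (2 * \<alpha> * \<gamma> / (\<sigma>\<^sup>2 * \<eta>)) (2 * \<alpha> * (\<eta> - \<gamma>) / (\<sigma>\<^sup>2 * \<eta>)) > 1 \<and>
       D \<le> 1 / 2 \<and>
       heat_scheme_solution P M N D \<psi>t u
       \<longrightarrow>
       (\<forall>n\<in>{1..N}.
          (\<forall>\<omega>\<in>space P. norm_dx dx M (\<lambda>m. u n m \<omega>) \<le> C_Tdx T dx * \<eta>t) \<and>
          integrable P (\<lambda>\<omega>. (norm_dx dx M (\<lambda>m. u n m \<omega>))\<^sup>2) \<and>
          prob_space.expectation P (\<lambda>\<omega>. (norm_dx dx M (\<lambda>m. u n m \<omega>))\<^sup>2)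
            \<le> (C_Tdx T dx)\<^sup>2 * \<eta>t\<^sup>2 \<and>
          (\<forall>\<omega>\<in>space P. norm_max M (\<lambda>m. u n m \<omega>) \<le> C_T T * \<eta>t) \<and>
          integrable P (\<lambda>\<omega>. norm_max M (\<lambda>m. u n m \<omega>)) \<and>
          prob_space.expectation P (\<lambda>\<omega>. norm_max M (\<lambda>m. u n m \<omega>)) \<le> C_T T * \<eta>t)"
  (is "\<exists>C_Tdx C_T. \<forall>P F W \<Psi> u T xbar M N dx dt D \<alpha> \<gamma> \<sigma> \<eta> lam c0 \<phi>1 \<phi>2 \<eta>t \<psi>0 k \<psi> \<psi>t.
      ?hyp P F W \<Psi> u T xbar M N dx dt D \<alpha> \<gamma> \<sigma> \<eta> lam c0 \<phi>1 \<phi>2 \<eta>t \<psi>0 k \<psi> \<psi>t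
      \<longrightarrow> ?concl C_Tdx C_T P u T M N dx \<eta>t")
proof (rule exI[of _ "\<lambda>T dx. sqrt (dx * (1 + 2 * (T / dx\<^sup>2)))"], rule exI[of _ "\<lambda>_. 1"],
    intro allI impI)
  fix P :: "'a measure" and F :: "real \<Rightarrow> 'a measure" and W \<Psi> :: "real \<Rightarrow> 'a \<Rightarrow> real"
    and u :: "nat \<Rightarrow> nat \<Rightarrow> 'a \<Rightarrow> real" and T xbar :: real and M N :: nat
    and dx dt D \<alpha> \<gamma> \<sigma> \<eta> lam c0 \<phi>1 \<phi>2 \<eta>t \<psi>0 k :: real and \<psi> \<psi>t :: "nat \<Rightarrow> 'a \<Rightarrow> real"
  assume "?hyp P F W \<Psi> u T xbar M N dx dt D \<alpha> \<gamma> \<sigma> \<eta> lam c0 \<phi>1 \<phi>2 \<eta>t \<psi>0 k \<psi> \<psi>t"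
  then have T: "T > 0" and "xbar > 0" and M: "M \<ge> 1" and N: "N \<ge> 1"
    and dx_eq: "dx = xbar / real M" and dt_eq: "dt = T / real N" and D_eq: "D = dt / dx\<^sup>2"
    and pos: "lam > 0" "c0 > 0" "\<phi>2 < 0" "phi \<phi>1 \<phi>2 c0 > 0"
    and \<eta>t: "\<eta>t = \<eta> / (\<phi>1 + c0 * \<phi>2)" and \<psi>0: "\<psi>0 \<in> {0..\<eta>}"
    and W: "wiener_process P F W"
    and sde: "sde_solution P F W T (\<lambda>x. \<alpha> * (\<gamma> - x)) (\<lambda>x. \<sigma> * sqrt (x * (\<eta> - x))) \<psi>0 \<Psi>"
    and \<Psi>: "\<forall>t\<in>{0..T}. \<forall>\<omega>\<in>space P. \<Psi> t \<omega> \<in> {0..\<eta>}"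
    and \<psi>: "\<psi> = psi_scheme (modified_drift \<alpha> \<gamma> \<sigma> \<eta> k dt) \<sigma> \<eta> \<psi>0 W dt"
    and \<psi>t: "\<psi>t = boundary_value \<psi> \<Psi> \<phi>1 \<phi>2 c0 lam dt"
    and D_le: "D \<le> 1 / 2" and sol: "heat_scheme_solution P M N D \<psi>t u"
    by blast+
  let ?C = "sqrt (dx * (1 + 2 * (T / dx\<^sup>2)))"
  have dx: "dx > 0" and dt: "dt > 0"
    using \<open>xbar > 0\<close> T M N by (auto simp: dx_eq dt_eq)
  then have D: "D > 0"
    by (simp add: D_eq)
  interpret prob_space P
    using W by (simp add: wiener_process_def)
  have time: "real n * dt \<le> T" if "n \<le> N" for n
    using that T N by (simp add: dt_eq field_simps)

  have \<psi>t_bounds: "0 \<le> \<psi>t n \<omega>" "\<psi>t n \<omega> \<le> \<eta>t" if "n \<le> N" "\<omega> \<in> space P" for n \<omega>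
  proof -
    have "\<And>s. s \<in> {0..real n * dt} \<Longrightarrow> 0 \<le> \<Psi> s \<omega>"
      using \<Psi> time that by fastforce
    moreover have "\<psi> n \<omega> \<in> {0..\<eta>}"
      unfolding \<psi> by (rule psi_scheme_bounds[OF \<psi>0])
    ultimately show "0 \<le> \<psi>t n \<omega>" "\<psi>t n \<omega> \<le> \<eta>t"
      using boundary_value_bounds[of \<psi> n \<omega> \<eta> dt \<Psi> lam c0 \<phi>2 \<phi>1] pos
      by (auto simp: \<psi>t \<eta>t phi_def mult.commute)
  qed
  \<comment> \<open>Freezing the sample point makes the deterministic bounds available with
    \<open>B\<close> equal to \<open>\<eta>t\<close>.\<close>
  have rec: "heat_recursion M N D \<eta>t (\<lambda>n. \<psi>t n \<omega>) (\<lambda>n m. u n m \<omega>)" if "\<omega> \<in> space P" for \<omega>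
    using that sol M D D_le \<psi>t_bounds
    by unfold_locales (auto simp: heat_scheme_solution_def)
  have \<eta>t_nonneg: "0 \<le> \<eta>t"
    using pos \<psi>0 by (auto simp: \<eta>t phi_def mult.commute)

  \<comment> \<open>\<open>W\<close> and \<Psi> are adapted; the inclusion of \<open>F t\<close> in
    \<open>P\<close> turns this into measurability with respect to \<open>P\<close>.\<close>
  have sub: "subalgebra P (F t)" if "0 \<le> t" for t
    using W that by (simp add: wiener_process_def)
  have W_meas: "W t \<in> borel_measurable P" if "0 \<le> t" for t
    using W that by (intro measurable_from_subalg[OF sub[OF that]]) (simp add: wiener_process_def)
  have \<Psi>_meas: "\<Psi> t \<in> borel_measurable P" if "t \<in> {0..T}" for t
    using sde that by (intro measurable_from_subalg[OF sub[of t]]) (auto simp: sde_solution_def)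
  have \<psi>t_meas: "\<psi>t n \<in> borel_measurable P" if "n \<le> N" for n
  proof -
    have [measurable]: "\<psi> n \<in> borel_measurable P"
      unfolding \<psi> using W_meas dt by (intro psi_scheme_measurable) auto
    have [measurable]: "(\<lambda>\<omega>. LINT s:{0..real n * dt}|lborel. \<Psi> s \<omega>) \<in> borel_measurable P"
    proof (rule time_integral_measurable)
      show "\<Psi> s \<in> borel_measurable P" if "s \<in> {0..real n * dt}" for s
        using \<Psi>_meas that time[OF \<open>n \<le> N\<close>] by simp
      show "continuous_on {0..real n * dt} (\<lambda>s. \<Psi> s \<omega>)" if "\<omega> \<in> space P" for \<omega>
        using sde that time[OF \<open>n \<le> N\<close>]
        by (auto simp: sde_solution_def intro: continuous_on_subset)
    qed
    show ?thesis
      unfolding \<psi>t boundary_value_def[abs_def] phi_def by measurable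
  qed
  have u_meas: "u n m \<in> borel_measurable P" if "n \<le> N" "m \<le> M" for n m
    using heat_scheme_solution_measurable[OF sol M] \<psi>t_meas that by blast

  show "?concl (\<lambda>T dx. sqrt (dx * (1 + 2 * (T / dx\<^sup>2)))) (\<lambda>_. 1) P u T M N dx \<eta>t"
  proof
    fix n assume "n \<in> {1..N}"
    then have n: "n \<le> N"
      by simp
    have "real n * D \<le> T / dx\<^sup>2"
      using time[OF n] dx by (simp add: D_eq divide_right_mono)
    then have C: "sqrt (dx * (1 + 2 * (real n * D))) \<le> ?C"
      using dx by (intro real_sqrt_le_mono mult_left_mono) auto
    have norm_dx: "norm_dx dx M (\<lambda>m. u n m \<omega>) \<le> ?C * \<eta>t" if "\<omega> \<in> space P" for \<omega>
      using heat_recursion.norm_dx_le[OF rec[OF that] n less_imp_le[OF dx]]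
        mult_right_mono[OF C \<eta>t_nonneg] by linarith
    have norm_max: "norm_max M (\<lambda>m. u n m \<omega>) \<le> 1 * \<eta>t" if "\<omega> \<in> space P" for \<omega>
      using heat_recursion.norm_max_le[OF rec[OF that] n] by simp
    have norm_dx_sq: "(norm_dx dx M (\<lambda>m. u n m \<omega>))\<^sup>2 \<le> ?C\<^sup>2 * \<eta>t\<^sup>2" if "\<omega> \<in> space P" for \<omega>
      using power_mono[OF norm_dx[OF that] norm_dx_nonneg] dx by (simp only: power_mult_distrib)
    have meas_dx: "(\<lambda>\<omega>. (norm_dx dx M (\<lambda>m. u n m \<omega>))\<^sup>2) \<in> borel_measurable P"
      unfolding norm_dx_def using u_meas[OF n] by simp
    have meas_max: "(\<lambda>\<omega>. norm_max M (\<lambda>m. u n m \<omega>)) \<in> borel_measurable P"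
      unfolding norm_max_def using u_meas[OF n] by (intro borel_measurable_Max) auto
    show "(\<forall>\<omega>\<in>space P. norm_dx dx M (\<lambda>m. u n m \<omega>) \<le> ?C * \<eta>t) \<and>
        integrable P (\<lambda>\<omega>. (norm_dx dx M (\<lambda>m. u n m \<omega>))\<^sup>2) \<and>
        expectation (\<lambda>\<omega>. (norm_dx dx M (\<lambda>m. u n m \<omega>))\<^sup>2) \<le> ?C\<^sup>2 * \<eta>t\<^sup>2 \<and>
        (\<forall>\<omega>\<in>space P. norm_max M (\<lambda>m. u n m \<omega>) \<le> 1 * \<eta>t) \<and>
        integrable P (\<lambda>\<omega>. norm_max M (\<lambda>m. u n m \<omega>)) \<and>
        expectation (\<lambda>\<omega>. norm_max M (\<lambda>m. u n m \<omega>)) \<le> 1 * \<eta>t"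
      using norm_dx norm_max
        expectation_bounded[OF meas_dx zero_le_power2 norm_dx_sq]
        expectation_bounded[OF meas_max norm_max_nonneg norm_max]
      by blast
  qed
qed

end
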